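(* Let $\mathcal A$ be an arrangement of $n\cdot k$ lines ($n\ge2$) in the complex projective plane for which: (a) the corresponding matrix $Q$ is a direct sum of $k$ equal blocks, so that the lines corresponding to each block are in general position; (b) any multiple point of the arrangement lies on a line from each group (the groups being the sets of lines corresponding to the blocks); (c) each line contains $n$ multiple points of the arrangement. Then $k\le5$.
   Context: Multiple points of $\mathcal A$ are points lying on at least three lines of $\mathcal A$. Let $\mathcal X$ be the set of multiple points, each identified with the set of lines of $\mathcal A$ through it. The matrix $Q=Q(\mathcal X)$ is $J^tJ-E$, where $J$ is the incidence matrix of $\mathcal X$ (rows indexed by the points of $\mathcal X$, columns by the lines, entry $1$ if the point lies on the line and $0$ otherwise) and $E$ is the square matrix with all entries $1$, of size the number of lines. The blocks of $Q$ are its indecomposable direct summands; they correspond to the connected components of the graph on the set of lines in which two lines are joined if their intersection point does not belong to $\mathcal X$. *)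

theory Defs
  imports "HOL-Analysis.Analysis"
begin

text \<open>
  Points and lines of the complex projective plane are the complex subspaces of
  \<open>complex ^ 3\<close> of dimension 1 and 2 (\<open>vec.subspace\<close> and \<open>vec.dim\<close> refer to the scalar
  multiplication by complex numbers); a point \<open>P\<close> lies on a line \<open>L\<close> iff \<open>P \<subseteq> L\<close>.
\<close>

definition proj_points :: "(complex ^ 3) set set" where
  "proj_points = {P. vec.subspace P \<and> vec.dim P = 1}"

definition proj_lines :: "(complex ^ 3) set set" where
  "proj_lines = {L. vec.subspace L \<and> vec.dim L = 2}"

definition lines_through :: "(complex ^ 3) set set \<Rightarrow> (complex ^ 3) set \<Rightarrow> (complex ^ 3) set set" where
  "lines_through \<A> P = {L \<in> \<A>. P \<subseteq> L}"

definition arrangement :: "(complex ^ 3) set set \<Rightarrow> bool" where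
  "arrangement \<A> \<longleftrightarrow> finite \<A> \<and> \<A> \<subseteq> proj_lines"

definition multiple_points :: "(complex ^ 3) set set \<Rightarrow> (complex ^ 3) set set" where
  "multiple_points \<A> = {P \<in> proj_points. card (lines_through \<A> P) \<ge> 3}"

definition general_position :: "(complex ^ 3) set set \<Rightarrow> bool" where
  "general_position \<B> \<longleftrightarrow> (\<forall>P \<in> proj_points. card (lines_through \<B> P) \<le> 2)"

definition incidence :: "(complex ^ 3) set \<Rightarrow> (complex ^ 3) set \<Rightarrow> int" where
  "incidence P L = (if P \<subseteq> L then 1 else 0)"

text \<open>
  The entries of \<open>J\<^sup>t J - E\<close>. The matrix is indexed by the lines themselves,
  so only the values at arguments in \<open>\<A>\<close> matter.
\<close>

definition Q_matrix ::
  "(complex ^ 3) set set \<Rightarrow> (complex ^ 3) set \<Rightarrow> (complex ^ 3) set \<Rightarrow> int" where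
  "Q_matrix \<A> L M = (\<Sum>P \<in> multiple_points \<A>. incidence P L * incidence P M) - 1"

text \<open>
  For a square matrix \<open>M\<close> with rows and columns indexed by a set \<open>I\<close>, a direct summand is
  given by its set \<open>S\<close> of indices: after a simultaneous reordering of rows and columns,
  \<open>M\<close> is block diagonal with the blocks \<open>S\<close> and \<open>I - S\<close>.
\<close>

definition direct_summand :: "'i set \<Rightarrow> ('i \<Rightarrow> 'i \<Rightarrow> int) \<Rightarrow> 'i set \<Rightarrow> bool" where
  "direct_summand I M S \<longleftrightarrow>
     S \<noteq> {} \<and> S \<subseteq> I \<and> (\<forall>i \<in> S. \<forall>j \<in> I - S. M i j = 0 \<and> M j i = 0)"

definition indecomposable :: "'i set \<Rightarrow> ('i \<Rightarrow> 'i \<Rightarrow> int) \<Rightarrow> bool" where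
  "indecomposable S M \<longleftrightarrow> (\<forall>T. direct_summand S M T \<longrightarrow> T = S)"

definition blocks :: "'i set \<Rightarrow> ('i \<Rightarrow> 'i \<Rightarrow> int) \<Rightarrow> 'i set set" where
  "blocks I M = {S. direct_summand I M S \<and> indecomposable S M}"

text \<open>
  Matrices indexed by different sets count as equal when they agree for a suitable
  ordering of the indices, the same for rows and columns.
\<close>

definition equal_blocks :: "('i \<Rightarrow> 'i \<Rightarrow> int) \<Rightarrow> 'i set \<Rightarrow> 'i set \<Rightarrow> bool" where
  "equal_blocks M S T \<longleftrightarrow>
     (\<exists>f. bij_betw f S T \<and> (\<forall>i \<in> S. \<forall>j \<in> S. M (f i) (f j) = M i j))"

definition sum_of_equal_blocks :: "nat \<Rightarrow> 'i set \<Rightarrow> ('i \<Rightarrow> 'i \<Rightarrow> int) \<Rightarrow> bool" where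
  "sum_of_equal_blocks k I M \<longleftrightarrow>
     card (blocks I M) = k \<and> (\<forall>S \<in> blocks I M. \<forall>T \<in> blocks I M. equal_blocks M S T)"

end

theory Submission
  imports Defs
begin

text \<open>
  Suppose that there are at least two blocks, of \<open>n\<close> lines each. Lines of different blocks meet
  in a multiple point, because the corresponding entry of \<open>Q\<close> vanishes. A line \<open>L\<close> has only \<open>n\<close>
  multiple points, and each of the \<open>n\<close> lines of another block passes through one of them; as
  every multiple point is on a line of that block, it is on exactly one. So the blocks are the
  classes of a net whose base points are the multiple points.

  Let \<open>F\<close> and \<open>G\<close> be the products of the linear forms of the lines in two of the classes. The
  vector field \<open>X = \<nabla>F \<times> \<nabla>G\<close>, of degree \<open>2n - 2\<close>, is tangent to all members of the pencil
  spanned by \<open>F\<close> and \<open>G\<close>. Let \<open>Y\<close> be its derivative along itself. The form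
  \<open>E(p) = det (p, X(p), Y(p))\<close>, here called the flex form, vanishes at the points where a member
  of the pencil is singular or has a flex. Its degree is \<open>1 + (2n - 2) + (4n - 5) = 6n - 6\<close>.

  The form \<open>E\<close> vanishes on each line \<open>L\<close> of the net (\<open>flex_vanishes\<close>). Indeed, if \<open>L\<close> belongs to
  a third class, then \<open>F\<close> and \<open>G\<close> have the same zeros on \<open>L\<close>, namely the base points, so they
  are proportional on \<open>L\<close>; if \<open>L\<close> belongs to one of the two classes, one of \<open>F\<close>, \<open>G\<close> vanishes
  on \<open>L\<close>. In either case \<open>L\<close> is invariant under \<open>X\<close>, so \<open>p\<close>, \<open>X(p)\<close> and \<open>Y(p)\<close> lie in one plane
  of \<open>complex ^ 3\<close>.

  On the other hand \<open>E\<close> is not identically zero (\<open>flex_at_node\<close>). Two lines of the first class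
  meet in a point \<open>q\<close> that is on no other line of that class, by general position, and on no
  line of the second class. In affine coordinates near \<open>q\<close>, the function \<open>F/G\<close> is \<open>x y\<close> times a
  unit, the field \<open>X\<close> is proportional to \<open>(x, -y)\<close> up to higher order, and the
  leading term of \<open>E\<close> is a nonzero multiple of \<open>x y\<close>.

  A nonzero form of degree \<open>6n - 6\<close> vanishes on at most \<open>6n - 6\<close> lines
  (\<open>flex_zero_everywhere\<close>), so \<open>n k \<le> 6n - 6 < 6n\<close>, that is, \<open>k \<le> 5\<close>.
\<close>

section \<open>Coordinates in complex three-space\<close>

text \<open>
  The inner product of the library is real bilinear; duality of points and lines needs the
  complex bilinear pairing.
\<close>
definition dot :: "complex ^ 3 \<Rightarrow> complex ^ 3 \<Rightarrow> complex" where
  "dot a p = a $ 1 * p $ 1 + a $ 2 * p $ 2 + a $ 3 * p $ 3"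

definition cross :: "complex ^ 3 \<Rightarrow> complex ^ 3 \<Rightarrow> complex ^ 3" where
  "cross x y = vector [x $ 2 * y $ 3 - x $ 3 * y $ 2,
                       x $ 3 * y $ 1 - x $ 1 * y $ 3,
                       x $ 1 * y $ 2 - x $ 2 * y $ 1]"

lemmas coordinates = dot_def cross_def vec_eq_iff forall_3 vector_3

lemma dot_commute: "dot x y = dot y x"
  by (simp add: dot_def)

lemma dot_linear [simp]:
  "dot (x + y) z = dot x z + dot y z" "dot z (x + y) = dot z x + dot z y"
  "dot (c *s x) z = c * dot x z" "dot z (c *s x) = c * dot z x"
  "dot (x - y) z = dot x z - dot y z" "dot z (x - y) = dot z x - dot z y"
  "dot (- x) z = - dot x z" "dot z (- x) = - dot z x"
  "dot 0 z = 0" "dot z 0 = 0"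
  by (simp_all add: dot_def algebra_simps)

lemma dot_cross_self [simp]: "dot a (cross a b) = 0" "dot b (cross a b) = 0"
  by (simp_all add: coordinates algebra_simps)

lemma cross_linear:
  "cross (x + y) z = cross x z + cross y z" "cross z (x + y) = cross z x + cross z y"
  "cross (c *s x) z = c *s cross x z" "cross z (c *s x) = c *s cross z x"
  by (simp_all add: coordinates algebra_simps)

lemma cross_minus: "cross (x - y) z = cross x z - cross y z" "cross z (x - y) = cross z x - cross z y"
  by (simp_all add: coordinates algebra_simps)

lemma cross_self [simp]: "cross x x = 0"
  by (simp add: coordinates)

lemma cross_swap: "cross x y = (- 1) *s cross y x"
  by (simp add: coordinates)

lemma nonzero_coordinate: "(x :: complex ^ 3) \<noteq> 0 \<Longrightarrow> x $ 1 \<noteq> 0 \<or> x $ 2 \<noteq> 0 \<or> x $ 3 \<noteq> 0"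
  by (auto simp: coordinates)

lemma parallel_if_cross_zero:
  assumes "cross x y = 0" "y \<noteq> 0" obtains c where "x = c *s y"
proof -
  have e: "x $ 2 * y $ 3 = x $ 3 * y $ 2" "x $ 3 * y $ 1 = x $ 1 * y $ 3"
    "x $ 1 * y $ 2 = x $ 2 * y $ 1"
    using assms(1) by (simp_all add: coordinates)
  from nonzero_coordinate[OF assms(2)] show ?thesis
  proof (elim disjE)
    assume "y $ 1 \<noteq> 0"
    with e have "x = (x $ 1 / y $ 1) *s y" by (simp add: coordinates field_simps)
    then show ?thesis by (rule that)
  next
    assume "y $ 2 \<noteq> 0"
    with e have "x = (x $ 2 / y $ 2) *s y" by (simp add: coordinates field_simps)
    then show ?thesis by (rule that)
  next
    assume "y $ 3 \<noteq> 0"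
    with e have "x = (x $ 3 / y $ 3) *s y" by (simp add: coordinates field_simps)
    then show ?thesis by (rule that)
  qed
qed

lemma common_zero_parallel_cross:
  assumes "dot a x = 0" "dot b x = 0" "cross a b \<noteq> 0"
  obtains c where "x = c *s cross a b"
proof (rule parallel_if_cross_zero[of x "cross a b"])
  have "cross x (cross a b) = dot b x *s a + (- dot a x) *s b"
    by (simp add: coordinates algebra_simps)
  then show "cross x (cross a b) = 0" using assms by simp
qed (use assms that in auto)

lemma multiple_of_covector:
  assumes "l \<noteq> 0" "\<And>v. dot l v = 0 \<Longrightarrow> dot m v = 0"
  obtains c where "m = c *s l"
proof (rule parallel_if_cross_zero[OF _ assms(1), of m])
  have "dot m (cross l e) = 0" for e by (rule assms(2)) simp
  from this[of "axis 1 1"] this[of "axis 2 1"] this[of "axis 3 1"]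
  show "cross m l = 0" by (simp add: coordinates axis_def algebra_simps)
qed (use that in auto)

text \<open>The curve \<open>s \<mapsto> (1, s, s\<^sup>2)\<close> meets every plane through the origin in at most two points.\<close>
lemma exists_off_planes:
  assumes "finite C" "0 \<notin> C" shows "\<exists>w. \<forall>c\<in>C. dot c w \<noteq> 0"
proof -
  let ?p = "\<lambda>c::complex^3. [:c $ 1, c $ 2, c $ 3:]"
  have "?p c \<noteq> 0" if "c \<in> C" for c
  proof
    assume "?p c = 0"
    then have "c = 0" by (simp add: coordinates)
    with that assms show False by simp
  qed
  then have "finite (\<Union>c\<in>C. {s. poly (?p c) s = 0})"
    using assms(1) poly_roots_finite by blast
  then obtain s where s: "s \<notin> (\<Union>c\<in>C. {s. poly (?p c) s = 0})"
    using ex_new_if_finite[OF infinite_UNIV_char_0] by blast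
  have "dot c (vector [1, s, s\<^sup>2]) = poly (?p c) s" for c
    by (simp add: dot_def power2_eq_square algebra_simps)
  with s show ?thesis by (intro exI[of _ "vector [1, s, s\<^sup>2]"]) auto
qed

text \<open>
  Cramer's rule, solved for \<open>p\<close> after pairing with a vector \<open>e\<close> outside the plane of \<open>u\<close> and \<open>v\<close>.
\<close>
lemma combination_if_coplanar:
  assumes "dot (cross u v) p = 0" "cross u v \<noteq> 0"
  obtains c d where "p = c *s u + d *s v"
proof -
  obtain e where e: "dot (cross u v) e \<noteq> 0"
    using exists_off_planes[of "{cross u v}"] assms(2) by auto
  have "dot (cross u v) e *s p
      = dot (cross p v) e *s u + dot (cross u p) e *s v + dot (cross u v) p *s e"
    by (simp add: coordinates algebra_simps)
  with assms(1) have *: "dot (cross u v) e *s p = dot (cross p v) e *s u + dot (cross u p) e *s v"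
    by simp
  have "p = (1 / dot (cross u v) e) *s (dot (cross u v) e *s p)" using e by simp
  also have "\<dots> = (dot (cross p v) e / dot (cross u v) e) *s u
      + (dot (cross u p) e / dot (cross u v) e) *s v"
    unfolding * by (simp add: vec.scale_right_distrib)
  finally show ?thesis by (rule that)
qed

text \<open>
  If three lines are concurrent, the forms of two of them are proportional on the third.
\<close>
lemma proportional_on_line:
  assumes "dot m' (cross l m) = 0" "cross l m \<noteq> 0"
  obtains c where "\<And>v. dot l v = 0 \<Longrightarrow> dot m' v = c * dot m v"
proof -
  from assms obtain d c where "m' = d *s l + c *s m"
    by (metis combination_if_coplanar dot_commute)
  then show ?thesis by (intro that[of c]) simp
qed

lemma triple_zero_on_line:
  assumes "l \<noteq> 0" "dot l x = 0" "dot l y = 0" "dot l z = 0"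
  shows "dot x (cross y z) = 0"
proof -
  have "dot x (cross y z) *s l
      = dot l x *s cross y z + dot l y *s cross z x + dot l z *s cross x y"
    by (simp add: coordinates algebra_simps)
  then have "dot x (cross y z) *s l = 0" using assms by simp
  then show ?thesis using assms(1) by simp
qed

section \<open>Functions that are polynomial along a line\<close>

text \<open>
  The bounds on \<open>d\<close> carry the homogeneous degrees, without a theory of polynomials in three
  variables: a form of degree \<open>d\<close> restricts to a polynomial of degree at most \<open>d\<close> on each
  parametrised line \<open>t \<mapsto> p + t w\<close>.
\<close>
definition polyfun :: "nat \<Rightarrow> (complex \<Rightarrow> complex) \<Rightarrow> bool" where
  "polyfun d f \<longleftrightarrow> (\<exists>P. degree P \<le> d \<and> f = poly P)"

lemma polyfun_const: "polyfun 0 (\<lambda>t. c)"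
  unfolding polyfun_def by (rule exI[of _ "[:c:]"]) auto

lemma polyfun_ident: "polyfun 1 (\<lambda>t. t)"
  unfolding polyfun_def by (rule exI[of _ "[:0,1:]"]) auto

lemma polyfun_mono: "polyfun d f \<Longrightarrow> d \<le> e \<Longrightarrow> polyfun e f"
  unfolding polyfun_def by (metis le_trans)

lemma polyfun_add: "polyfun d f \<Longrightarrow> polyfun d g \<Longrightarrow> polyfun d (\<lambda>t. f t + g t)"
  unfolding polyfun_def
proof safe
  fix P Q :: "complex poly" assume "degree P \<le> d" "degree Q \<le> d"
  then show "\<exists>R. degree R \<le> d \<and> (\<lambda>t. poly P t + poly Q t) = poly R"
    by (intro exI[of _ "P + Q"]) (auto intro: degree_add_le)
qed

lemma polyfun_mult: "polyfun d f \<Longrightarrow> polyfun e g \<Longrightarrow> polyfun (d + e) (\<lambda>t. f t * g t)"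
  unfolding polyfun_def
proof safe
  fix P Q :: "complex poly" assume "degree P \<le> d" "degree Q \<le> e"
  then show "\<exists>R. degree R \<le> d + e \<and> (\<lambda>t. poly P t * poly Q t) = poly R"
    using degree_mult_le[of P Q] by (intro exI[of _ "P * Q"]) auto
qed

lemma polyfun_diff: "polyfun d f \<Longrightarrow> polyfun d g \<Longrightarrow> polyfun d (\<lambda>t. f t - g t)"
  using polyfun_add[of d f "\<lambda>t. (-1) * g t"] polyfun_mult[OF polyfun_const[of "-1"], of d g]
  by simp

lemma polyfun_sum:
  "(\<And>i. i \<in> A \<Longrightarrow> polyfun d (f i)) \<Longrightarrow> polyfun d (\<lambda>t. \<Sum>i\<in>A. f i t)"
  by (induction A rule: infinite_finite_induct)
    (auto intro: polyfun_add polyfun_mono[OF polyfun_const])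

lemma polyfun_prod:
  "(\<And>i. i \<in> A \<Longrightarrow> polyfun 1 (f i)) \<Longrightarrow> polyfun (card A) (\<lambda>t. \<Prod>i\<in>A. f i t)"
proof (induction A rule: infinite_finite_induct)
  case (insert i A)
  then have "polyfun (1 + card A) (\<lambda>t. f i t * (\<Prod>i\<in>A. f i t))"
    by (intro polyfun_mult) auto
  with insert show ?case by simp
qed (auto intro: polyfun_const)

lemma polyfun_zero:
  assumes "polyfun d f" "finite Z" "card Z > d" "\<And>t. t \<in> Z \<Longrightarrow> f t = 0"
  shows "f t = 0"
proof -
  obtain P where P: "degree P \<le> d" "f = poly P" using assms(1) by (auto simp: polyfun_def)
  have "P = 0"
  proof (rule ccontr)
    assume "P \<noteq> 0"
    then have "card Z \<le> card {t. poly P t = 0}"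
      using assms(4) P by (intro card_mono poly_roots_finite) auto
    also have "\<dots> \<le> degree P" using \<open>P \<noteq> 0\<close> by (rule card_poly_roots_bound)
    finally show False using P assms(3) by simp
  qed
  with P show ?thesis by simp
qed

definition vpolyfun :: "nat \<Rightarrow> (complex \<Rightarrow> complex ^ 3) \<Rightarrow> bool" where
  "vpolyfun d f \<longleftrightarrow> (\<forall>k. polyfun d (\<lambda>t. f t $ k))"

lemma vpolyfun_mono: "vpolyfun d f \<Longrightarrow> d \<le> e \<Longrightarrow> vpolyfun e f"
  unfolding vpolyfun_def by (auto intro: polyfun_mono)

lemma vpolyfun_const: "vpolyfun 0 (\<lambda>t. c)"
  unfolding vpolyfun_def by (auto intro: polyfun_const)

lemma vpolyfun_add: "vpolyfun d f \<Longrightarrow> vpolyfun d g \<Longrightarrow> vpolyfun d (\<lambda>t. f t + g t)"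
  unfolding vpolyfun_def by (auto intro: polyfun_add)

lemma vpolyfun_sum:
  "(\<And>i. i \<in> A \<Longrightarrow> vpolyfun d (f i)) \<Longrightarrow> vpolyfun d (\<lambda>t. \<Sum>i\<in>A. f i t)"
  unfolding vpolyfun_def by (auto intro: polyfun_sum)

lemma vpolyfun_scale: "polyfun d f \<Longrightarrow> vpolyfun e g \<Longrightarrow> vpolyfun (d + e) (\<lambda>t. f t *s g t)"
  unfolding vpolyfun_def by (auto intro: polyfun_mult)

lemma polyfun_dot: "vpolyfun d f \<Longrightarrow> vpolyfun e g \<Longrightarrow> polyfun (d + e) (\<lambda>t. dot (f t) (g t))"
  unfolding vpolyfun_def dot_def by (intro polyfun_add polyfun_mult) auto

lemma vpolyfun_cross: "vpolyfun d f \<Longrightarrow> vpolyfun e g \<Longrightarrow> vpolyfun (d + e) (\<lambda>t. cross (f t) (g t))"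
  unfolding vpolyfun_def cross_def forall_3 vector_3
  by (intro conjI polyfun_diff polyfun_mult) auto

lemma vpolyfun_line: "vpolyfun 1 (\<lambda>t. p + t *s w)"
proof -
  have "vpolyfun (1 + 0) (\<lambda>t. t *s w)" by (intro vpolyfun_scale polyfun_ident vpolyfun_const)
  then show ?thesis by (intro vpolyfun_add vpolyfun_mono[OF vpolyfun_const]) auto
qed

section \<open>Products of linear forms and the flex form of a pencil\<close>

definition form :: "('i \<Rightarrow> complex ^ 3) \<Rightarrow> 'i set \<Rightarrow> complex ^ 3 \<Rightarrow> complex" where
  "form a I p = (\<Prod>i\<in>I. dot (a i) p)"

definition grad :: "('i \<Rightarrow> complex ^ 3) \<Rightarrow> 'i set \<Rightarrow> complex ^ 3 \<Rightarrow> complex ^ 3" where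
  "grad a I p = (\<Sum>i\<in>I. form a (I - {i}) p *s a i)"

text \<open>
  The Hessian matrix of the product \<open>form a I\<close> at \<open>p\<close>, applied to \<open>u\<close>.
\<close>
definition hess :: "('i \<Rightarrow> complex ^ 3) \<Rightarrow> 'i set \<Rightarrow> complex ^ 3 \<Rightarrow> complex ^ 3 \<Rightarrow> complex ^ 3" where
  "hess a I p u = (\<Sum>i\<in>I. dot (grad a (I - {i}) p) u *s a i)"

text \<open>
  The vector field that is tangent to the members of the pencil spanned by the two products.
\<close>
definition tangent where
  "tangent a I J p = cross (grad a I p) (grad a J p)"

text \<open>
  The derivative of the field \<open>tangent\<close> in its own direction, by the product rule.
\<close>
definition acceleration where
  "acceleration a I J p = cross (hess a I p (tangent a I J p)) (grad a J p)
     + cross (grad a I p) (hess a J p (tangent a I J p))"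

text \<open>
  The determinant of position, velocity and acceleration on an integral curve of \<open>tangent\<close>: its
  zeros are the base points of the pencil and the singular points and flexes of its members.
\<close>
definition flex where
  "flex a I J p = dot p (cross (tangent a I J p) (acceleration a I J p))"

lemma form_insert: "finite I \<Longrightarrow> i \<notin> I \<Longrightarrow> form a (insert i I) p = dot (a i) p * form a I p"
  by (simp add: form_def)

lemma grad_insert:
  assumes "finite I" "i \<notin> I"
  shows "grad a (insert i I) p = form a I p *s a i + dot (a i) p *s grad a I p"
proof -
  have "form a (insert i I - {j}) p = dot (a i) p * form a (I - {j}) p" if "j \<in> I" for j
  proof -
    have "insert i I - {j} = insert i (I - {j})" using that assms by auto
    then show ?thesis using assms by (simp add: form_insert)
  qed
  then show ?thesis
    using assms by (simp add: grad_def vec.scale_sum_right)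
qed

lemma hess_insert:
  assumes "finite I" "i \<notin> I"
  shows "hess a (insert i I) p u = dot (grad a I p) u *s a i + dot (a i) u *s grad a I p
           + dot (a i) p *s hess a I p u"
proof -
  have "grad a (insert i I - {j}) p = form a (I - {j}) p *s a i + dot (a i) p *s grad a (I - {j}) p"
    if "j \<in> I" for j
  proof -
    have "insert i I - {j} = insert i (I - {j})" using that assms by auto
    then show ?thesis using assms by (simp add: grad_insert)
  qed
  then show ?thesis
    using assms
    by (simp add: hess_def grad_def[of a I] vec.scale_sum_right vec.scale_left_distrib sum.distrib
        mult_ac)
qed

text \<open>
  Euler's identity for homogeneous functions.
\<close>
lemma euler_form:
  assumes "finite I" shows "dot (grad a I p) p = of_nat (card I) * form a I p"
  using assms by (induction I) (simp_all add: grad_def[of _ "{}"] grad_insert form_insert algebra_simps)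

lemma hess_scale: "hess a I p (c *s u) = c *s hess a I p u"
  by (simp add: hess_def vec.scale_sum_right)

lemma component_restriction_zero:
  assumes "finite I" "i \<in> I" "dot (a i) p = 0" "dot (a i) v = 0"
  shows "dot (grad a I p) v = 0" "dot (a i) u = 0 \<Longrightarrow> dot (hess a I p u) v = 0"
proof -
  have I: "I = insert i (I - {i})" using assms by auto
  show "dot (grad a I p) v = 0"
    by (subst I, subst grad_insert) (use assms in auto)
  show "dot (hess a I p u) v = 0" if "dot (a i) u = 0"
    by (subst I, subst hess_insert) (use assms that in auto)
qed

text \<open>
  Proportional linear factors on a line give proportional products there, hence proportional
  first and second derivatives in the directions of the line.
\<close>
lemma restriction_proportional:
  assumes "finite I" "bij_betw \<sigma> I J"
    and c: "\<And>i v. i \<in> I \<Longrightarrow> dot l v = 0 \<Longrightarrow> dot (a (\<sigma> i)) v = c i * dot (a i) v"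
    and p: "dot l p = 0" and u: "dot l u = 0" and v: "dot l v = 0"
  shows "form a J p = prod c I * form a I p"
    "dot (grad a J p) v = prod c I * dot (grad a I p) v"
    "dot (hess a J p u) v = prod c I * dot (hess a I p u) v"
proof -
  have "form a J p = prod c I * form a I p \<and> dot (grad a J p) v = prod c I * dot (grad a I p) v
     \<and> dot (grad a J p) u = prod c I * dot (grad a I p) u
     \<and> dot (hess a J p u) v = prod c I * dot (hess a I p u) v"
    using assms(1,2) c
  proof (induction I arbitrary: J)
    case empty
    then show ?case by (simp add: form_def grad_def hess_def bij_betw_def)
  next
    case (insert i I)
    define K where "K = \<sigma> ` I"
    have K: "J = insert (\<sigma> i) K" "\<sigma> i \<notin> K" "finite K" "bij_betw \<sigma> I K"
      using insert.prems(1) insert.hyps by (auto simp: bij_betw_def K_def)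
    note IH = insert.IH[OF K(4) insert.prems(2)]
    have i: "dot (a (\<sigma> i)) w = c i * dot (a i) w" if "dot l w = 0" for w
      using insert.prems(2) that by simp
    show ?case
      using IH K insert.hyps i[OF p] i[OF u] i[OF v]
      by (simp add: form_insert grad_insert hess_insert) (simp add: algebra_simps)
  qed
  then show "form a J p = prod c I * form a I p"
    "dot (grad a J p) v = prod c I * dot (grad a I p) v"
    "dot (hess a J p u) v = prod c I * dot (hess a I p u) v"
    by auto
qed

text \<open>
  For the products \<open>F\<close> and \<open>G\<close> of the two families, the hypotheses say that the first and second
  derivatives of \<open>c F - d G\<close> at \<open>p\<close> vanish in the directions of the line \<open>l\<close>. So
  \<open>c \<nabla>F - d \<nabla>G\<close> is a multiple of \<open>l\<close>, and \<open>\<nabla>F \<times> \<nabla>G\<close> lies in the plane of \<open>l\<close>; the same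
  argument with the second derivatives puts the acceleration there. Allowing one of \<open>c\<close>, \<open>d\<close> to be
  zero covers the lines that are components of \<open>F\<close> or of \<open>G\<close>.
\<close>
lemma flex_vanishes:
  assumes l: "l \<noteq> 0" "dot l p = 0" and c: "c \<noteq> 0 \<or> d \<noteq> 0"
    and g: "\<And>v. dot l v = 0 \<Longrightarrow> c * dot (grad a I p) v = d * dot (grad a J p) v"
    and h: "\<And>u v. dot l u = 0 \<Longrightarrow> dot l v = 0 \<Longrightarrow> c * dot (hess a I p u) v = d * dot (hess a J p u) v"
  shows "flex a I J p = 0"
proof -
  let ?g = "grad a I p" and ?h = "grad a J p" and ?X = "tangent a I J p"
  let ?g' = "hess a I p ?X" and ?h' = "hess a J p ?X"
  have "dot (c *s ?g + (- d) *s ?h) v = 0" if "dot l v = 0" for v using g[OF that] by simp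
  from multiple_of_covector[OF l(1) this] obtain s where "c *s ?g + (- d) *s ?h = s *s l" by blast
  then have s: "c *s ?g = s *s l + d *s ?h" "d *s ?h = c *s ?g + (- s) *s l"
    by (simp_all add: vec_eq_iff algebra_simps)
  have "c * dot l ?X = dot l (cross (c *s ?g) ?h)" "d * dot l ?X = dot l (cross ?g (d *s ?h))"
    by (simp_all only: tangent_def cross_linear dot_linear)
  moreover have "dot l (cross (c *s ?g) ?h) = 0"
    by (subst s(1)) (simp add: cross_linear cross_minus)
  moreover have "dot l (cross ?g (d *s ?h)) = 0"
    by (subst s(2)) (simp add: cross_linear cross_minus)
  ultimately have "c * dot l ?X = 0" "d * dot l ?X = 0" by metis+
  then have X: "dot l ?X = 0" using c by auto
  have "dot (c *s ?g' + (- d) *s ?h') v = 0" if "dot l v = 0" for v using h[OF X that] by simp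
  from multiple_of_covector[OF l(1) this] obtain r where "c *s ?g' + (- d) *s ?h' = r *s l" by blast
  then have r: "c *s ?g' = r *s l + d *s ?h'" "d *s ?h' = c *s ?g' + (- r) *s l"
    by (simp_all add: vec_eq_iff algebra_simps)
  let ?Y = "acceleration a I J p"
  have "c * dot l ?Y = dot l (cross (c *s ?g') ?h) + dot l (cross (c *s ?g) ?h')"
    "d * dot l ?Y = dot l (cross ?g' (d *s ?h)) + dot l (cross ?g (d *s ?h'))"
    by (simp_all add: acceleration_def cross_linear algebra_simps)
  moreover have "dot l (cross (c *s ?g') ?h) + dot l (cross (c *s ?g) ?h') = 0"
    by (subst s(1), subst r(1)) (simp add: cross_linear cross_minus cross_swap[of ?h' ?h])
  moreover have "dot l (cross ?g' (d *s ?h)) + dot l (cross ?g (d *s ?h')) = 0"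
    by (subst s(2), subst r(2)) (simp add: cross_linear cross_minus cross_swap[of ?g' ?g])
  ultimately have "c * dot l ?Y = 0" "d * dot l ?Y = 0" by metis+
  then have "dot l (acceleration a I J p) = 0" using c by auto
  then show ?thesis unfolding flex_def by (rule triple_zero_on_line[OF l(1,2) X])
qed

lemma polyfun_form: "polyfun (card I) (\<lambda>t. form a I (p + t *s w))"
  unfolding form_def
  using polyfun_dot[OF vpolyfun_const vpolyfun_line] by (intro polyfun_prod) simp

lemma vpolyfun_grad: "vpolyfun (card I - 1) (\<lambda>t. grad a I (p + t *s w))"
  unfolding grad_def
proof (rule vpolyfun_sum)
  fix i assume "i \<in> I"
  have "vpolyfun (card (I - {i}) + 0) (\<lambda>t. form a (I - {i}) (p + t *s w) *s a i)"
    by (intro vpolyfun_scale polyfun_form vpolyfun_const)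
  then show "vpolyfun (card I - 1) (\<lambda>t. form a (I - {i}) (p + t *s w) *s a i)"
    using \<open>i \<in> I\<close> by simp
qed

lemma vpolyfun_hess:
  assumes "vpolyfun d u" shows "vpolyfun (card I - 2 + d) (\<lambda>t. hess a I (p + t *s w) (u t))"
  unfolding hess_def
proof (rule vpolyfun_sum)
  fix i assume "i \<in> I"
  have "vpolyfun ((card (I - {i}) - 1 + d) + 0) (\<lambda>t. dot (grad a (I - {i}) (p + t *s w)) (u t) *s a i)"
    by (intro vpolyfun_scale polyfun_dot vpolyfun_grad vpolyfun_const assms)
  then show "vpolyfun (card I - 2 + d) (\<lambda>t. dot (grad a (I - {i}) (p + t *s w)) (u t) *s a i)"
    using \<open>i \<in> I\<close> by (simp add: numeral_2_eq_2)
qed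

lemma polyfun_flex:
  assumes "card I = n" "card J = n" "n \<ge> 2"
  shows "polyfun (6 * n - 6) (\<lambda>t. flex a I J (p + t *s w))"
proof -
  have X: "vpolyfun ((n - 1) + (n - 1)) (\<lambda>t. tangent a I J (p + t *s w))"
    unfolding tangent_def
    using vpolyfun_grad[of I a p w] vpolyfun_grad[of J a p w] assms by (intro vpolyfun_cross) auto
  have Y1: "vpolyfun ((n - 2 + ((n - 1) + (n - 1))) + (n - 1))
      (\<lambda>t. cross (hess a I (p + t *s w) (tangent a I J (p + t *s w))) (grad a J (p + t *s w)))"
    using vpolyfun_hess[OF X, of I a p w] vpolyfun_grad[of J a p w] assms by (intro vpolyfun_cross) auto
  have Y2: "vpolyfun ((n - 1) + (n - 2 + ((n - 1) + (n - 1))))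
      (\<lambda>t. cross (grad a I (p + t *s w)) (hess a J (p + t *s w) (tangent a I J (p + t *s w))))"
    using vpolyfun_hess[OF X, of J a p w] vpolyfun_grad[of I a p w] assms by (intro vpolyfun_cross) auto
  have "vpolyfun (4 * n - 5) (\<lambda>t. acceleration a I J (p + t *s w))"
    unfolding acceleration_def
    by (intro vpolyfun_add vpolyfun_mono[OF Y1] vpolyfun_mono[OF Y2]) (use assms in auto)
  then have "polyfun (1 + (((n - 1) + (n - 1)) + (4 * n - 5))) (\<lambda>t. flex a I J (p + t *s w))"
    unfolding flex_def by (intro polyfun_dot vpolyfun_cross vpolyfun_line X)
  then show ?thesis by (rule polyfun_mono) (use assms in auto)
qed

text \<open>
  A point \<open>p\<close> off all the lines is joined to a general point \<open>w\<close>: the line \<open>p + t w\<close> meets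
  the given lines for pairwise distinct parameters \<open>t\<close>, which are more than the degree of the
  restricted form.
\<close>
lemma flex_zero_everywhere:
  assumes "finite A" "card A > 6 * n - 6" "card I = n" "card J = n" "n \<ge> 2"
    and indep: "\<And>i j. i \<in> A \<Longrightarrow> j \<in> A \<Longrightarrow> i \<noteq> j \<Longrightarrow> cross (a i) (a j) \<noteq> 0"
    and nz: "\<And>i. i \<in> A \<Longrightarrow> a i \<noteq> 0"
    and van: "\<And>i p. i \<in> A \<Longrightarrow> dot (a i) p = 0 \<Longrightarrow> flex a I J p = 0"
  shows "flex a I J p = 0"
proof (cases "\<exists>i\<in>A. dot (a i) p = 0")
  case True
  then show ?thesis using van by blast
next
  case False
  \<comment> \<open>The form \<open>m i j\<close> is the line joining \<open>p\<close> to the intersection of lines \<open>i\<close> and \<open>j\<close>. It has to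
    avoid \<open>w\<close>, because otherwise the two lines meet \<open>p + t w\<close> for the same parameter.\<close>
  define m where "m i j = dot (a i) p *s a j + (- dot (a j) p) *s a i" for i j
  have m: "m i j \<noteq> 0" if "i \<in> A" "j \<in> A" "i \<noteq> j" for i j
  proof
    assume "m i j = 0"
    have "dot (a i) p *s cross (a i) (a j) = cross (a i) (m i j)"
      by (simp add: m_def coordinates algebra_simps)
    also have "\<dots> = 0" using \<open>m i j = 0\<close> by (simp add: coordinates)
    finally show False using indep[OF that] False that by simp
  qed
  let ?C = "a ` A \<union> (\<lambda>(i, j). m i j) ` {(i, j). i \<in> A \<and> j \<in> A \<and> i \<noteq> j}"
  have finC: "finite ?C"
    using assms(1) by (auto intro!: finite_subset[of "{(i, j). i \<in> A \<and> j \<in> A \<and> i \<noteq> j}" "A \<times> A"])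
  have "0 \<notin> ?C" using m nz by force
  from exists_off_planes[OF finC this] obtain w where w: "\<forall>c\<in>?C. dot c w \<noteq> 0" ..
  define r where "r i = - dot (a i) p / dot (a i) w" for i
  have aw: "dot (a i) w \<noteq> 0" if "i \<in> A" for i using w that by auto
  have "inj_on r A"
  proof (rule inj_onI, rule ccontr)
    fix i j assume ij: "i \<in> A" "j \<in> A" "r i = r j" "i \<noteq> j"
    then have "dot (m i j) w \<noteq> 0" using w by auto
    with ij aw show False by (simp add: m_def r_def field_simps)
  qed
  then have "card (r ` A) > 6 * n - 6" using assms by (simp add: card_image)
  moreover have "flex a I J (p + t *s w) = 0" if "t \<in> r ` A" for t
  proof -
    from that obtain i where i: "i \<in> A" "t = r i" by auto
    have "dot (a i) (p + t *s w) = 0" using i aw[OF i(1)] by (simp add: r_def)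
    then show ?thesis by (rule van[OF i(1)])
  qed
  ultimately have "flex a I J (p + 0 *s w) = 0"
    using assms(1) by (intro polyfun_zero[OF polyfun_flex[OF assms(3-5), of a p w], of "r ` A" 0]) simp_all
  then show ?thesis by simp
qed

lemma dot_cross_cross:
  "dot q (cross (cross u g) (cross w g)) = dot g (cross u w) * dot g q"
  by (simp add: coordinates algebra_simps)

text \<open>
  The leading coefficient of the flex form at a node with tangents \<open>a\<close>, \<open>b\<close>, see \<open>flex_at_node\<close>. The
  linear part of the field has the eigenvectors \<open>b \<times> g\<close> and \<open>a \<times> g\<close> with opposite eigenvalues, so it
  maps the sum of two eigenvectors to a multiple of their difference.
\<close>
lemma node_determinant:
  assumes "x = R *s cross (\<beta> *s a + \<alpha> *s b) g"
  shows "dot q (cross x (cross (R *s (dot b x *s a + dot a x *s b)) g))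
     = 2 * R ^ 3 * \<alpha> * \<beta> * (dot g (cross a b)) ^ 2 * dot g q"
proof -
  define D where "D = dot g (cross a b)"
  define u where "u = \<beta> *s a + \<alpha> *s b"
  define v where "v = \<alpha> *s b + (- \<beta>) *s a"
  have ax: "dot a x = R * \<alpha> * D" and bx: "dot b x = - (R * \<beta> * D)"
    unfolding assms D_def coordinates vector_add_component vector_smult_component by algebra+
  have x: "x = R *s cross u g" using assms by (simp add: u_def)
  have y: "cross (R *s (dot b x *s a + dot a x *s b)) g = (R ^ 2 * D) *s cross v g"
    unfolding ax bx v_def by (simp add: coordinates algebra_simps power2_eq_square)
  have "dot g (cross u v) = 2 * \<alpha> * \<beta> * D"
    unfolding D_def u_def v_def coordinates vector_add_component vector_smult_component by algebra
  then show ?thesis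
    unfolding y unfolding x D_def[symmetric]
    by (simp add: cross_linear dot_cross_cross power2_eq_square power3_eq_cube)
qed

text \<open>
  On a line \<open>q + t v\<close> through the node the field has a simple zero at \<open>t = 0\<close>, hence so does the
  acceleration. Thus the flex form is \<open>t\<^sup>2 \<phi> t\<close> with \<open>\<phi>\<close> polynomial, and \<open>\<phi> 0\<close> is computed
  explicitly. If the form were identically zero, \<open>\<phi> 0\<close> would vanish.
\<close>
lemma flex_at_node:
  assumes I: "finite I" "i \<in> I" "j \<in> I"
    and q: "q \<noteq> 0" "dot (a i) q = 0" "dot (a j) q = 0" "cross (a i) (a j) \<noteq> 0"
    and others: "\<And>k. k \<in> I - {i, j} \<Longrightarrow> dot (a k) q \<noteq> 0"
    and J: "finite J" "J \<noteq> {}" "\<And>k. k \<in> J \<Longrightarrow> dot (a k) q \<noteq> 0"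
  shows "\<exists>p. flex a I J p \<noteq> 0"
proof (rule ccontr)
  assume "\<nexists>p. flex a I J p \<noteq> 0"
  then have zero: "flex a I J p = 0" for p by blast
  define K where "K = I - {i, j}"
  have "i \<noteq> j" using q by auto
  then have IK: "I = insert i (insert j K)" "i \<notin> insert j K" "j \<notin> K" "finite K"
    using I by (auto simp: K_def)
  have "a i \<noteq> 0" "a j \<noteq> 0" using q(4) by (auto simp: coordinates)
  then obtain v where v: "dot (a i) v \<noteq> 0" "dot (a j) v \<noteq> 0"
    using exists_off_planes[of "{a i, a j}"] by auto
  define \<alpha> where "\<alpha> = dot (a i) v"
  define \<beta> where "\<beta> = dot (a j) v"
  define P where "P = (\<lambda>t. q + t *s v)"
  \<comment> \<open>The functions \<open>\<gamma>\<close>, \<open>x\<close>, \<open>y\<close> are the gradient of the first product, the velocity and the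
    acceleration, each divided by \<open>t\<close>.\<close>
  define \<gamma> where "\<gamma> = (\<lambda>t. form a K (P t) *s (\<beta> *s a i + \<alpha> *s a j) + (t * \<alpha> * \<beta>) *s grad a K (P t))"
  define x where "x = (\<lambda>t. cross (\<gamma> t) (grad a J (P t)))"
  define y where "y = (\<lambda>t. cross (hess a I (P t) (x t)) (grad a J (P t))
      + t *s cross (\<gamma> t) (hess a J (P t) (x t)))"
  have aP: "dot (a i) (P t) = t * \<alpha>" "dot (a j) (P t) = t * \<beta>" for t
    using q by (simp_all add: P_def \<alpha>_def \<beta>_def)
  have grad: "grad a I (P t) = t *s \<gamma> t" for t
    using IK by (simp add: grad_insert form_insert aP \<gamma>_def vec.scale_right_distrib algebra_simps)
  have tan: "tangent a I J (P t) = t *s x t" for t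
    by (simp add: tangent_def grad x_def cross_linear)
  have acc: "acceleration a I J (P t) = t *s y t" for t
    by (simp add: acceleration_def tan grad hess_scale cross_linear y_def vec.scale_right_distrib)
  define \<phi> where "\<phi> = (\<lambda>t. dot (P t) (cross (x t) (y t)))"
  have flex: "flex a I J (P t) = t ^ 2 * \<phi> t" for t
    by (simp add: flex_def tan acc cross_linear \<phi>_def power2_eq_square)
  obtain d where d: "polyfun d \<phi>"
  proof -
    have line: "vpolyfun 1 P" unfolding P_def by (rule vpolyfun_line)
    have form: "polyfun (card S) (\<lambda>t. form a S (P t))" for S
      unfolding P_def by (rule polyfun_form)
    have gr: "vpolyfun (card S - 1) (\<lambda>t. grad a S (P t))" for S
      unfolding P_def by (rule vpolyfun_grad)
    have he: "vpolyfun (card S - 2 + e) (\<lambda>t. hess a S (P t) (u t))" if "vpolyfun e u" for S e u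
      unfolding P_def by (rule vpolyfun_hess[OF that])
    have "vpolyfun (card K + 1) (\<lambda>t. form a K (P t) *s (\<beta> *s a i + \<alpha> *s a j))"
      using vpolyfun_scale[OF form vpolyfun_const] by (rule vpolyfun_mono) simp
    moreover have "polyfun 1 (\<lambda>t. t * (\<alpha> * \<beta>))"
      using polyfun_mult[OF polyfun_ident polyfun_const, of "\<alpha> * \<beta>"] by simp
    then have "vpolyfun (card K + 1) (\<lambda>t. (t * \<alpha> * \<beta>) *s grad a K (P t))"
      using vpolyfun_mono[OF vpolyfun_scale[OF _ gr], of 1 "\<lambda>t. t * \<alpha> * \<beta>" K "card K + 1"]
      by (simp add: mult.assoc)
    ultimately have \<gamma>: "vpolyfun (card K + 1) \<gamma>"
      unfolding \<gamma>_def by (rule vpolyfun_add)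
    have x: "vpolyfun (card K + 1 + (card J - 1)) x"
      unfolding x_def by (rule vpolyfun_cross[OF \<gamma> gr])
    note y1 = vpolyfun_cross[OF he[OF x, of I] gr[of J]]
    note y2 = vpolyfun_scale[OF polyfun_ident vpolyfun_cross[OF \<gamma> he[OF x, of J]]]
    note y = vpolyfun_add[OF vpolyfun_mono[OF y1 le_add1] vpolyfun_mono[OF y2 le_add2], folded y_def]
    show ?thesis
      by (rule that, unfold \<phi>_def) (rule polyfun_dot[OF line vpolyfun_cross[OF x y]])
  qed
  have \<phi>0: "\<phi> 0 = 0"
  proof (rule polyfun_zero[OF d])
    show "card (of_nat ` {1..Suc d} :: complex set) > d"
      by (subst card_image) (auto simp: inj_on_def)
    fix t :: complex assume "t \<in> of_nat ` {1..Suc d}"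
    then have "t \<noteq> 0" by auto
    with flex[of t] zero show "\<phi> t = 0" by simp
  qed simp
  \<comment> \<open>At \<open>t = 0\<close> only the linear part of the field at the node survives.\<close>
  define g where "g = grad a J q"
  define R where "R = form a K q"
  have P0: "P 0 = q" by (simp add: P_def)
  have x0: "x 0 = R *s cross (\<beta> *s a i + \<alpha> *s a j) g"
    by (simp add: x_def \<gamma>_def P0 R_def g_def cross_linear)
  have h0: "hess a I q u = R *s (dot (a j) u *s a i + dot (a i) u *s a j)" for u
    using IK q by (simp add: hess_insert grad_insert form_insert R_def vec.scale_right_distrib mult_ac)
  have y0: "y 0 = cross (R *s (dot (a j) (x 0) *s a i + dot (a i) (x 0) *s a j)) g"
    by (simp only: y_def P0 h0 g_def) simp
  have "\<phi> 0 = 2 * R ^ 3 * \<alpha> * \<beta> * (dot g (cross (a i) (a j))) ^ 2 * dot g q"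
    unfolding \<phi>_def P0 y0 by (rule node_determinant[OF x0])
  moreover have "R \<noteq> 0" using IK others by (auto simp: R_def form_def K_def)
  moreover have gq: "dot g q \<noteq> 0"
    using J by (simp add: g_def euler_form form_def)
  moreover have "dot g (cross (a i) (a j)) \<noteq> 0"
    using gq common_zero_parallel_cross[OF q(2-4)] by (metis dot_linear(4) mult_zero_right)
  ultimately show False using \<phi>0 v by (simp add: \<alpha>_def \<beta>_def)
qed

section \<open>Points and lines in coordinates\<close>

lemma subspace_kernel: "vec.subspace {p. dot l p = 0}"
  by (simp add: vec.subspace_def)

text \<open>
  The form is the cross product of two basis vectors.
\<close>
lemma proj_line_covector:
  assumes "L \<in> proj_lines" shows "\<exists>l. l \<noteq> 0 \<and> L = {p. dot l p = 0}"
proof -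
  have L: "vec.subspace L" "vec.dim L = 2" using assms by (auto simp: proj_lines_def)
  obtain B where B: "B \<subseteq> L" "vec.independent B" "L \<subseteq> vec.span B" "card B = 2"
    using vec.basis_exists[of L] L by metis
  then obtain u v where uv: "B = {u, v}" "u \<noteq> v" by (auto simp: card_2_iff)
  have N: "cross u v \<noteq> 0"
  proof
    assume "cross u v = 0"
    moreover have "v \<noteq> 0" using B(2) uv vec.dependent_zero by auto
    ultimately obtain c where "u = c *s v" by (rule parallel_if_cross_zero)
    then have "u \<in> vec.span (B - {u})"
      using uv by (simp add: vec.span_base vec.span_scale insert_Diff_if)
    with B(2) uv show False unfolding vec.dependent_def by auto
  qed
  have "L = {p. dot (cross u v) p = 0}"
  proof
    have "vec.span B \<subseteq> {p. dot (cross u v) p = 0}"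
      by (rule vec.span_minimal[OF _ subspace_kernel])
        (use uv in \<open>auto simp: dot_commute[of "cross u v"]\<close>)
    with B show "L \<subseteq> {p. dot (cross u v) p = 0}" by blast
    show "{p. dot (cross u v) p = 0} \<subseteq> L"
    proof clarify
      fix p assume "dot (cross u v) p = 0"
      from combination_if_coplanar[OF this N] obtain c d where "p = c *s u + d *s v" .
      then show "p \<in> L"
        using B(1) uv L(1) by (simp add: vec.subspace_add vec.subspace_scale)
    qed
  qed
  with N show ?thesis by blast
qed

definition covector :: "(complex ^ 3) set \<Rightarrow> complex ^ 3" where
  "covector L = (SOME l. l \<noteq> 0 \<and> L = {p. dot l p = 0})"

lemma covector:
  assumes "L \<in> proj_lines"
  shows "covector L \<noteq> 0" "p \<in> L \<longleftrightarrow> dot (covector L) p = 0"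
proof -
  have "covector L \<noteq> 0 \<and> L = {p. dot (covector L) p = 0}"
    unfolding covector_def by (rule someI_ex[OF proj_line_covector[OF assms]])
  then show "covector L \<noteq> 0" "p \<in> L \<longleftrightarrow> dot (covector L) p = 0" by blast+
qed

definition meet :: "(complex ^ 3) set \<Rightarrow> (complex ^ 3) set \<Rightarrow> complex ^ 3" where
  "meet L M = cross (covector L) (covector M)"

lemma meet_nonzero:
  assumes "L \<in> proj_lines" "M \<in> proj_lines" "L \<noteq> M" shows "meet L M \<noteq> 0"
proof
  assume "meet L M = 0"
  then obtain c where c: "covector L = c *s covector M"
    using parallel_if_cross_zero covector(1)[OF assms(2)] unfolding meet_def by metis
  then have "c \<noteq> 0" using covector(1)[OF assms(1)] by auto
  with c have "p \<in> L \<longleftrightarrow> p \<in> M" for p by (simp add: covector assms)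
  with assms(3) show False by blast
qed

lemma span_point: "q \<noteq> 0 \<Longrightarrow> vec.span {q} \<in> proj_points"
  by (simp add: proj_points_def vec.dim_eq_card_independent vec.independent_insert)

lemma span_subset_line: "L \<in> proj_lines \<Longrightarrow> vec.span {q} \<subseteq> L \<longleftrightarrow> q \<in> L"
  using vec.span_minimal[of "{q}" L] vec.span_base[of q "{q}"]
  by (auto simp: proj_lines_def)

lemma point_is_meet:
  assumes "L \<in> proj_lines" "M \<in> proj_lines" "L \<noteq> M" "P \<in> proj_points" "P \<subseteq> L" "P \<subseteq> M"
  shows "P = vec.span {meet L M}"
proof -
  have P: "vec.subspace P" "vec.dim P = 1" using assms by (auto simp: proj_points_def)
  obtain B where B: "B \<subseteq> P" "vec.independent B" "P \<subseteq> vec.span B" "card B = 1"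
    using vec.basis_exists[of P] P by metis
  then obtain q where q: "B = {q}" by (auto simp: card_1_singleton_iff)
  then have "q \<noteq> 0" using B(2) vec.dependent_zero by auto
  have "q \<in> L" "q \<in> M" using assms B q by auto
  then obtain c where c: "q = c *s meet L M"
    using common_zero_parallel_cross meet_nonzero[OF assms(1-3)] unfolding meet_def
    by (metis assms(1,2) covector(2))
  then have "c \<noteq> 0" using \<open>q \<noteq> 0\<close> by auto
  then have "meet L M = (1 / c) *s q" using c by simp
  then have "meet L M \<in> P" using B(1) q P(1) by (simp add: vec.subspace_scale)
  then have "vec.span {meet L M} \<subseteq> P" using vec.span_minimal[of "{meet L M}" P] P(1) by simp
  moreover have "q \<in> vec.span {meet L M}" by (simp add: c vec.span_base vec.span_scale)
  then have "vec.span B \<subseteq> vec.span {meet L M}" using q vec.span_minimal[of B] by simp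
  ultimately show ?thesis using B(3) by blast
qed

section \<open>Direct summands of a matrix\<close>

text \<open>
  A direct summand of least cardinality among those containing \<open>i\<close> is indecomposable: if it split
  properly, the part containing \<open>i\<close> would be smaller.
\<close>
lemma in_block:
  assumes "finite I" "i \<in> I" shows "\<exists>S \<in> blocks I M. i \<in> S"
proof -
  define D where "D S \<longleftrightarrow> direct_summand I M S \<and> i \<in> S" for S
  have "D I" using assms by (auto simp: D_def direct_summand_def)
  then obtain S where S: "D S" and min: "\<And>T. D T \<Longrightarrow> card S \<le> card T"
    using ex_has_least_nat[of D I card] by blast
  have "S \<subseteq> I" using S by (simp add: D_def direct_summand_def)
  then have fin: "finite S" using assms(1) finite_subset by blast
  have "indecomposable S M"
    unfolding indecomposable_def
  proof (intro allI impI, rule ccontr)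
    fix T assume T: "direct_summand S M T" "T \<noteq> S"
    then have "T \<noteq> {}" "T \<subset> S" by (auto simp: direct_summand_def)
    have "direct_summand I M T" "direct_summand I M (S - T)"
      using S T \<open>T \<subset> S\<close> unfolding D_def direct_summand_def by blast+
    then have "D T \<or> D (S - T)" using S by (auto simp: D_def)
    moreover have "card T < card S" "card (S - T) < card S"
      using \<open>T \<noteq> {}\<close> \<open>T \<subset> S\<close> fin by (auto intro!: psubset_card_mono)
    ultimately show False using min by force
  qed
  with S show ?thesis by (auto simp: D_def blocks_def)
qed

text \<open>
  The intersection of two direct summands is a direct summand of both of them.
\<close>
lemma blocks_disjoint:
  assumes "S \<in> blocks I M" "T \<in> blocks I M" "S \<inter> T \<noteq> {}" shows "S = T"
proof -
  have S: "direct_summand I M S" "indecomposable S M" and T: "direct_summand I M T" "indecomposable T M"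
    using assms by (auto simp: blocks_def)
  have "direct_summand S M (S \<inter> T)" "direct_summand T M (S \<inter> T)"
    using S(1) T(1) assms(3) unfolding direct_summand_def by blast+
  then have "S \<inter> T = S" "S \<inter> T = T"
    using S(2) T(2) unfolding indecomposable_def by blast+
  then show ?thesis by simp
qed

lemma card_block:
  assumes "finite I" "sum_of_equal_blocks k I M" "card I = n * k" "S \<in> blocks I M"
  shows "card S = n"
proof -
  have sub: "T \<subseteq> I" if "T \<in> blocks I M" for T
    using that by (simp add: blocks_def direct_summand_def)
  then have fin: "finite (blocks I M)" using finite_subset[of "blocks I M" "Pow I"] assms(1) by blast
  have same: "card T = card S" if "T \<in> blocks I M" for T
    using assms(2,4) that bij_betw_same_card unfolding sum_of_equal_blocks_def equal_blocks_def by metis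
  have "I = \<Union> (blocks I M)" using in_block[OF assms(1)] sub by blast
  then have "card I = card (\<Union> (blocks I M))" by simp
  also have "\<dots> = (\<Sum>T\<in>blocks I M. card T)"
  proof (rule card_Union_disjoint)
    show "pairwise disjnt (blocks I M)"
      using blocks_disjoint by (metis disjnt_def pairwiseI)
    show "finite T" if "T \<in> blocks I M" for T using sub[OF that] assms(1) finite_subset by blast
  qed
  also have "\<dots> = k * card S" using same assms(2) by (simp add: sum_of_equal_blocks_def)
  finally have "k * n = k * card S" using assms(3) by (simp add: mult.commute)
  moreover have "k \<noteq> 0" using assms(2,4) fin by (auto simp: sum_of_equal_blocks_def card_gt_0_iff)
  ultimately show ?thesis by simp
qed

section \<open>Nets of lines\<close>

text \<open>
  Apart from general position, the argument with the flex form uses only these properties of the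
  blocks and the multiple points.
\<close>
locale net =
  fixes \<K> :: "(complex ^ 3) set set set" and \<X> :: "(complex ^ 3) set set" and n :: nat
  assumes class_lines: "S \<in> \<K> \<Longrightarrow> S \<subseteq> proj_lines"
    and class_card: "S \<in> \<K> \<Longrightarrow> card S = n"
    and n_ge_2: "n \<ge> 2"
    and classes_disjoint: "S \<in> \<K> \<Longrightarrow> T \<in> \<K> \<Longrightarrow> S \<noteq> T \<Longrightarrow> S \<inter> T = {}"
    and base_points: "\<X> \<subseteq> proj_points"
    and base_point_exists: "S \<in> \<K> \<Longrightarrow> T \<in> \<K> \<Longrightarrow> S \<noteq> T \<Longrightarrow> L \<in> S \<Longrightarrow> M \<in> T
      \<Longrightarrow> \<exists>P\<in>\<X>. P \<subseteq> L \<and> P \<subseteq> M"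
    and line_exists: "P \<in> \<X> \<Longrightarrow> S \<in> \<K> \<Longrightarrow> \<exists>L\<in>S. P \<subseteq> L"
    and line_unique: "P \<in> \<X> \<Longrightarrow> S \<in> \<K> \<Longrightarrow> L \<in> S \<Longrightarrow> M \<in> S \<Longrightarrow> P \<subseteq> L \<Longrightarrow> P \<subseteq> M
      \<Longrightarrow> L = M"
begin

lemma class_finite: "S \<in> \<K> \<Longrightarrow> finite S"
  using class_card n_ge_2 by (metis card.infinite not_numeral_le_zero)

lemma line: "L \<in> S \<Longrightarrow> S \<in> \<K> \<Longrightarrow> L \<in> proj_lines"
  using class_lines by blast

lemma base_point_is_meet:
  assumes "P \<in> \<X>" "L \<in> proj_lines" "M \<in> proj_lines" "L \<noteq> M" "P \<subseteq> L" "P \<subseteq> M"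
  shows "P = vec.span {meet L M}"
  using point_is_meet assms base_points by blast

text \<open>
  The forms of two classes have the same zeros on a line \<open>L\<close> of a third class. The bijection matches
  the lines of the two classes that meet \<open>L\<close> in the same base point.
\<close>
lemma restriction_bijection:
  assumes D: "D \<in> \<K>" "L \<in> D" and B: "B \<in> \<K>" "D \<noteq> B" and C: "C \<in> \<K>" "D \<noteq> C"
  obtains \<sigma> c where "bij_betw \<sigma> B C"
    "\<And>M v. M \<in> B \<Longrightarrow> dot (covector L) v = 0
       \<Longrightarrow> dot (covector (\<sigma> M)) v = c M * dot (covector M) v"
proof -
  have LP: "L \<in> proj_lines" using line D by blast
  have LB: "L \<notin> B" and LC: "L \<notin> C" using classes_disjoint D B C by blast+
  have "\<exists>M'. M' \<in> C \<and> meet L M \<in> M'" if M: "M \<in> B" for M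
  proof -
    from base_point_exists[OF D(1) B D(2) M] obtain P where P: "P \<in> \<X>" "P \<subseteq> L" "P \<subseteq> M" by blast
    from line_exists[OF P(1) C(1)] obtain M' where M': "M' \<in> C" "P \<subseteq> M'" by blast
    have "P = vec.span {meet L M}"
      using base_point_is_meet[OF P(1) LP line[OF M B(1)]] P M LB by blast
    with M' have "meet L M \<in> M'" using span_subset_line[OF line[OF M'(1) C(1)]] by simp
    with M' show ?thesis by blast
  qed
  then obtain \<sigma> where \<sigma>: "\<sigma> M \<in> C" "meet L M \<in> \<sigma> M" if "M \<in> B" for M by metis
  have inj: "inj_on \<sigma> B"
  proof (rule inj_onI)
    fix M M' assume M: "M \<in> B" "M' \<in> B" "\<sigma> M = \<sigma> M'"
    have N: "\<sigma> M \<in> proj_lines" using line \<sigma>(1)[OF M(1)] C(1) by blast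
    from base_point_exists[OF D(1) C D(2) \<sigma>(1)[OF M(1)]] obtain P
      where P: "P \<in> \<X>" "P \<subseteq> L" "P \<subseteq> \<sigma> M" by blast
    have neq: "L \<noteq> \<sigma> M" using \<sigma>(1)[OF M(1)] LC by blast
    have through: "P \<subseteq> K" if K: "K \<in> B" "\<sigma> K = \<sigma> M" for K
    proof -
      have KP: "K \<in> proj_lines" using line K B by blast
      have "L \<noteq> K" using K LB by blast
      from base_point_exists[OF D(1) B D(2) K(1)] obtain R
        where R: "R \<in> \<X>" "R \<subseteq> L" "R \<subseteq> K" by blast
      have RK: "R = vec.span {meet L K}" by (rule base_point_is_meet[OF R(1) LP KP \<open>L \<noteq> K\<close> R(2,3)])
      then have "R \<subseteq> \<sigma> M" using \<sigma>(2)[OF K(1)] span_subset_line[OF N] K(2) by simp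
      then have "R = vec.span {meet L (\<sigma> M)}" by (rule base_point_is_meet[OF R(1) LP N neq R(2)])
      moreover have "P = vec.span {meet L (\<sigma> M)}" by (rule base_point_is_meet[OF P(1) LP N neq P(2,3)])
      ultimately show ?thesis using R(3) by simp
    qed
    show "M = M'"
      by (rule line_unique[OF P(1) B(1) M(1,2) through[OF M(1)] through[OF M(2)]]) (use M in auto)
  qed
  have "\<sigma> ` B = C"
  proof (rule card_subset_eq[OF class_finite[OF C(1)]])
    show "\<sigma> ` B \<subseteq> C" using \<sigma> by blast
    show "card (\<sigma> ` B) = card C" using class_card B C by (simp add: card_image[OF inj])
  qed
  then have bij: "bij_betw \<sigma> B C" using inj by (simp add: bij_betw_def)
  have "\<exists>c. \<forall>v. dot (covector L) v = 0 \<longrightarrow> dot (covector (\<sigma> M)) v = c * dot (covector M) v"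
    if M: "M \<in> B" for M
  proof -
    have MP: "M \<in> proj_lines" and MP': "\<sigma> M \<in> proj_lines" and "L \<noteq> M"
      using line M B C \<sigma>(1)[OF M] LB by blast+
    have "dot (covector (\<sigma> M)) (meet L M) = 0" using covector(2)[OF MP'] \<sigma>(2)[OF M] by blast
    then obtain c where "\<And>v. dot (covector L) v = 0 \<Longrightarrow> dot (covector (\<sigma> M)) v = c * dot (covector M) v"
      using proportional_on_line[of "covector (\<sigma> M)" "covector L" "covector M"]
        meet_nonzero[OF LP MP \<open>L \<noteq> M\<close>] unfolding meet_def by blast
    then show ?thesis by blast
  qed
  then obtain c where "\<forall>M\<in>B. \<forall>v. dot (covector L) v = 0
      \<longrightarrow> dot (covector (\<sigma> M)) v = c M * dot (covector M) v" by metis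
  with bij show ?thesis by (intro that[of \<sigma> c]) blast+
qed

lemma flex_vanishes_on_net:
  assumes B: "B \<in> \<K>" and C: "C \<in> \<K>" and D: "D \<in> \<K>" "L \<in> D" and p: "dot (covector L) p = 0"
  shows "flex covector B C p = 0"
proof -
  have l: "covector L \<noteq> 0" using covector(1) line D by blast
  note fv = flex_vanishes[OF l p, of _ _ covector B C]
  consider "L \<in> B" | "L \<in> C" | "D \<noteq> B" "D \<noteq> C" using D by blast
  then show ?thesis
  proof cases
    case 1
    show ?thesis
      by (rule fv[of 1 0]) (use component_restriction_zero[where a = covector, OF class_finite[OF B] 1 p] in auto)
  next
    case 2
    show ?thesis
      by (rule fv[of 0 1]) (use component_restriction_zero[where a = covector, OF class_finite[OF C] 2 p] in auto)
  next
    case 3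
    obtain \<sigma> c where \<sigma>: "bij_betw \<sigma> B C" "\<And>M v. M \<in> B \<Longrightarrow> dot (covector L) v = 0
         \<Longrightarrow> dot (covector (\<sigma> M)) v = c M * dot (covector M) v"
      using restriction_bijection[OF D B 3(1) C 3(2)] by blast
    show ?thesis
    proof (rule fv[of "prod c B" 1])
      fix v assume v: "dot (covector L) v = 0"
      show "prod c B * dot (grad covector B p) v = 1 * dot (grad covector C p) v"
        using restriction_proportional(2)[where a = covector and l = "covector L",
            OF class_finite[OF B] \<sigma>(1) \<sigma>(2) p v v] by simp
    next
      fix u v assume u: "dot (covector L) u = 0" and v: "dot (covector L) v = 0"
      show "prod c B * dot (hess covector B p u) v = 1 * dot (hess covector C p u) v"
        using restriction_proportional(3)[where a = covector and l = "covector L",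
            OF class_finite[OF B] \<sigma>(1) \<sigma>(2) p u v] by simp
    qed simp
  qed
qed

lemma flex_nonzero:
  assumes B: "B \<in> \<K>" "general_position B" and C: "C \<in> \<K>" "B \<noteq> C"
  shows "\<exists>p. flex covector B C p \<noteq> 0"
proof -
  have "\<not> card B \<le> Suc 0" using class_card[OF B(1)] n_ge_2 by simp
  then obtain L M where LM: "L \<in> B" "M \<in> B" "L \<noteq> M"
    using card_le_Suc0_iff_eq[OF class_finite[OF B(1)]] by blast
  note LP = line[OF LM(1) B(1)] and MP = line[OF LM(2) B(1)]
  define q where "q = meet L M"
  have q0: "q \<noteq> 0" unfolding q_def by (rule meet_nonzero[OF LP MP LM(3)])
  have qLM: "dot (covector L) q = 0" "dot (covector M) q = 0" by (simp_all add: q_def meet_def)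
  have on: "vec.span {q} \<subseteq> N \<longleftrightarrow> dot (covector N) q = 0" if "N \<in> proj_lines" for N
    using span_subset_line[OF that] covector(2)[OF that] by simp
  show ?thesis
  proof (rule flex_at_node[OF class_finite[OF B(1)] LM(1,2) q0 qLM])
    show "cross (covector L) (covector M) \<noteq> 0" using q0 by (simp add: q_def meet_def)
    show "finite C" by (rule class_finite[OF C(1)])
    show "C \<noteq> {}" using class_card[OF C(1)] n_ge_2 by auto
    show "dot (covector N) q \<noteq> 0" if N: "N \<in> B - {L, M}" for N
    proof
      assume Nq: "dot (covector N) q = 0"
      have NP: "N \<in> proj_lines" using line N B by blast
      have "{L, M, N} \<subseteq> lines_through B (vec.span {q})"
        using N LM qLM Nq on[OF LP] on[OF MP] on[OF NP] by (simp add: lines_through_def)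
      moreover have "finite (lines_through B (vec.span {q}))"
        using class_finite[OF B(1)] by (simp add: lines_through_def)
      ultimately have "card {L, M, N} \<le> card (lines_through B (vec.span {q}))"
        by (rule card_mono[rotated])
      moreover have "card (lines_through B (vec.span {q})) \<le> 2"
        using B(2) span_point[OF q0] by (simp add: general_position_def)
      moreover have "card {L, M, N} = 3" using N LM(3) by (simp add: card_insert_if) metis
      ultimately show False by simp
    qed
    \<comment> \<open>A line \<open>N\<close> of the other class through \<open>q\<close> would make \<open>q\<close> a base point, but \<open>q\<close> is on the two
      lines \<open>L\<close> and \<open>M\<close> of one class.\<close>
    show "dot (covector N) q \<noteq> 0" if N: "N \<in> C" for N
    proof
      assume Nq: "dot (covector N) q = 0"
      have NP: "N \<in> proj_lines" using line N C by blast
      have "L \<noteq> N" using classes_disjoint[OF B(1) C] LM(1) N by blast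
      from base_point_exists[OF B(1) C LM(1) N] obtain P
        where P: "P \<in> \<X>" "P \<subseteq> L" "P \<subseteq> N" by blast
      have "P = vec.span {meet L N}" by (rule base_point_is_meet[OF P(1) LP NP \<open>L \<noteq> N\<close> P(2,3)])
      moreover have "vec.span {q} = vec.span {meet L N}"
        by (rule point_is_meet[OF LP NP \<open>L \<noteq> N\<close> span_point[OF q0]])
          (use on[OF LP] on[OF NP] qLM Nq in simp_all)
      ultimately have "P \<subseteq> M" using on[OF MP] qLM by simp
      with line_unique[OF P(1) B(1) LM(1,2) P(2)] LM(3) show False by blast
    qed
  qed
qed

lemma card_classes_le_5:
  assumes fin: "finite \<K>" and B: "B \<in> \<K>" "general_position B"
  shows "card \<K> \<le> 5"
proof (rule ccontr)
  assume k: "\<not> card \<K> \<le> 5"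
  have "\<not> \<K> \<subseteq> {B}"
  proof
    assume "\<K> \<subseteq> {B}"
    then have "card \<K> \<le> card {B}" by (intro card_mono) simp_all
    with k show False by simp
  qed
  then obtain C where C: "C \<in> \<K>" "B \<noteq> C" by blast
  have "card (\<Union> \<K>) = (\<Sum>S\<in>\<K>. card S)"
    by (rule card_Union_disjoint) (auto simp: pairwise_def disjnt_def classes_disjoint class_finite)
  also have "\<dots> = card \<K> * n" using class_card by simp
  finally have card: "card (\<Union> \<K>) = card \<K> * n" .
  have "6 * n \<le> card \<K> * n" using k by (intro mult_right_mono) auto
  then have "card (\<Union> \<K>) > 6 * n - 6" using card n_ge_2 by linarith
  then have "flex covector B C p = 0" for p
  proof (rule flex_zero_everywhere[rotated, where a = covector])
    show "finite (\<Union> \<K>)" using fin class_finite by blast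
    show "card B = n" "card C = n" "n \<ge> 2" using class_card B C n_ge_2 by auto
    show "cross (covector L) (covector M) \<noteq> 0" if "L \<in> \<Union> \<K>" "M \<in> \<Union> \<K>" "L \<noteq> M" for L M
      using meet_nonzero[of L M] that class_lines unfolding meet_def by blast
    show "covector L \<noteq> 0" if "L \<in> \<Union> \<K>" for L using covector(1) that class_lines by blast
    show "flex covector B C p = 0" if "L \<in> \<Union> \<K>" "dot (covector L) p = 0" for L p
      using flex_vanishes_on_net B C that by blast
  qed
  with flex_nonzero[OF B C] show False by blast
qed

end

section \<open>The net of an arrangement\<close>

lemma common_multiple_point:
  assumes "S \<in> blocks \<A> (Q_matrix \<A>)" "T \<in> blocks \<A> (Q_matrix \<A>)" "S \<noteq> T" "L \<in> S" "M \<in> T"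
  obtains P where "P \<in> multiple_points \<A>" "P \<subseteq> L" "P \<subseteq> M"
proof -
  have "M \<in> \<A> - S"
    using assms blocks_disjoint[OF assms(1,2)] by (auto simp: blocks_def direct_summand_def)
  then have "Q_matrix \<A> L M = 0"
    using assms(1,4) by (auto simp: blocks_def direct_summand_def)
  then have "(\<Sum>P \<in> multiple_points \<A>. incidence P L * incidence P M) \<noteq> 0"
    by (simp add: Q_matrix_def)
  then obtain P where "P \<in> multiple_points \<A>" "incidence P L * incidence P M \<noteq> 0"
    by (rule sum.not_neutral_contains_not_neutral)
  then show ?thesis by (intro that[of P]) (auto simp: incidence_def split: if_splits)
qed

text \<open>
  Counting on a line \<open>L\<close> of another block: each of the \<open>n\<close> lines of \<open>S\<close> meets \<open>L\<close> in a multiple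
  point, and this map to the \<open>n\<close> multiple points on \<open>L\<close> is surjective, hence injective.
\<close>
lemma one_line_per_block:
  assumes "arrangement \<A>"
    and S: "S \<in> blocks \<A> (Q_matrix \<A>)" "finite S" "card S = n"
    and T: "T \<in> blocks \<A> (Q_matrix \<A>)" "T \<noteq> S"
    and on: "\<And>P U. P \<in> multiple_points \<A> \<Longrightarrow> U \<in> blocks \<A> (Q_matrix \<A>) \<Longrightarrow> \<exists>L\<in>U. P \<subseteq> L"
    and n: "\<And>L. L \<in> \<A> \<Longrightarrow> card {P \<in> multiple_points \<A>. P \<subseteq> L} = n"
    and P: "P \<in> multiple_points \<A>"
    and M: "M \<in> S" "P \<subseteq> M" and M': "M' \<in> S" "P \<subseteq> M'"
  shows "M = M'"
proof -
  have sub: "U \<subseteq> \<A>" if "U \<in> blocks \<A> (Q_matrix \<A>)" for U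
    using that by (simp add: blocks_def direct_summand_def)
  have pl: "\<A> \<subseteq> proj_lines" using assms(1) by (simp add: arrangement_def)
  obtain L where L: "L \<in> T" "P \<subseteq> L" using on[OF P T(1)] by blast
  have LP: "L \<in> proj_lines" using L sub[OF T(1)] pl by blast
  let ?X = "{P \<in> multiple_points \<A>. P \<subseteq> L}"
  have cX: "card ?X = n" using n L sub[OF T(1)] by blast
  let ?f = "\<lambda>M. vec.span {meet L M}"
  have f: "?f M = R" if "M \<in> S" "R \<in> ?X" "R \<subseteq> M" for M R
  proof (rule point_is_meet[symmetric, OF LP])
    show "M \<in> proj_lines" using that sub[OF S(1)] pl by blast
    show "L \<noteq> M" using blocks_disjoint[OF T(1) S(1)] T(2) L that by blast
    show "R \<in> proj_points" "R \<subseteq> L" "R \<subseteq> M" using that by (auto simp: multiple_points_def)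
  qed
  have "?f ` S = ?X"
  proof
    show "?f ` S \<subseteq> ?X"
    proof (rule image_subsetI)
      fix M assume "M \<in> S"
      from common_multiple_point[OF T(1) S(1) T(2) L(1) this] obtain R
        where "R \<in> multiple_points \<A>" "R \<subseteq> L" "R \<subseteq> M" .
      with f[OF \<open>M \<in> S\<close>, of R] show "?f M \<in> ?X" by simp
    qed
    show "?X \<subseteq> ?f ` S"
    proof
      fix R assume R: "R \<in> ?X"
      then obtain M where M: "M \<in> S" "R \<subseteq> M" using on S(1) by blast
      show "R \<in> ?f ` S" using f[OF M(1) R M(2)] M(1) by blast
    qed
  qed
  then have "inj_on ?f S" using cX S by (intro eq_card_imp_inj_on) simp_all
  moreover have "?f M = ?f M'" using f[OF M(1) _ M(2)] f[OF M'(1) _ M'(2)] P L by simp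
  ultimately show ?thesis using M M' by (auto dest: inj_onD)
qed

theorem proposition7p3:
  fixes n k :: nat and \<A> :: "(complex ^ 3) set set"
  assumes "n \<ge> 2"
    and "arrangement \<A>"
    and "card \<A> = n * k"
    and "sum_of_equal_blocks k \<A> (Q_matrix \<A>)"
    and "\<forall>\<B> \<in> blocks \<A> (Q_matrix \<A>). general_position \<B>"
    and "\<forall>P \<in> multiple_points \<A>. \<forall>\<B> \<in> blocks \<A> (Q_matrix \<A>). \<exists>L \<in> \<B>. P \<subseteq> L"
    and "\<forall>L \<in> \<A>. card {P \<in> multiple_points \<A>. P \<subseteq> L} = n"
  shows "k \<le> 5"
proof (cases "k \<le> 1")
  case False
  let ?K = "blocks \<A> (Q_matrix \<A>)"
  have A: "finite \<A>" "\<A> \<subseteq> proj_lines" using assms(2) by (auto simp: arrangement_def)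
  have cardK: "card ?K = k" using assms(4) by (simp add: sum_of_equal_blocks_def)
  then have finK: "finite ?K" using False by (intro card_ge_0_finite) simp
  have sub: "S \<subseteq> \<A>" if "S \<in> ?K" for S using that by (simp add: blocks_def direct_summand_def)
  have other: "\<exists>T\<in>?K. T \<noteq> S" for S
  proof (rule ccontr)
    assume "\<not> ?thesis"
    then have "card ?K \<le> card {S}" by (intro card_mono) auto
    with cardK False show False by simp
  qed
  interpret net ?K "multiple_points \<A>" n
  proof
    show "n \<ge> 2" by (rule assms(1))
    show "multiple_points \<A> \<subseteq> proj_points" by (auto simp: multiple_points_def)
    show "S \<subseteq> proj_lines" if "S \<in> ?K" for S using sub[OF that] A by blast
    show card: "card S = n" if "S \<in> ?K" for S by (rule card_block[OF A(1) assms(4,3) that])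
    show "S \<inter> T = {}" if "S \<in> ?K" "T \<in> ?K" "S \<noteq> T" for S T
      using blocks_disjoint that by blast
    show "\<exists>P\<in>multiple_points \<A>. P \<subseteq> L \<and> P \<subseteq> M"
      if "S \<in> ?K" "T \<in> ?K" "S \<noteq> T" "L \<in> S" "M \<in> T" for S T L M
    proof -
      from common_multiple_point[OF that] obtain P
        where "P \<in> multiple_points \<A>" "P \<subseteq> L" "P \<subseteq> M" .
      then show ?thesis by blast
    qed
    show on: "\<exists>L\<in>S. P \<subseteq> L" if "P \<in> multiple_points \<A>" "S \<in> ?K" for P S
      using assms(6) that by blast
    show "L = M" if P: "P \<in> multiple_points \<A>" and S: "S \<in> ?K"
      and LM: "L \<in> S" "M \<in> S" "P \<subseteq> L" "P \<subseteq> M" for P S L M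
    proof -
      obtain T where T: "T \<in> ?K" "T \<noteq> S" using other by blast
      show ?thesis
      proof (rule one_line_per_block[OF assms(2) S _ _ T on _ P LM(1,3,2,4)])
        show "finite S" using sub[OF S] A(1) finite_subset by blast
        show "card S = n" by (rule card[OF S])
        show "card {P \<in> multiple_points \<A>. P \<subseteq> L} = n" if "L \<in> \<A>" for L using assms(7) that by blast
      qed
    qed
  qed
  obtain B where "B \<in> ?K" using other by blast
  then show ?thesis using card_classes_le_5[OF finK] assms(5) cardK by blast
qed simp

end
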